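(* Let $q$ be a prime power and $m\ge0$ an integer. Then, for $n\ge 1$, $$\sum_{i=0}^\infty\left|\mathrm{Prob}\left(\mathrm{corank}\,M=i \mid M\in\mathrm{Mat}_{n\times(n+m)}(\mathbb{F}_q)\right)-\pi_m(i)\right|=\frac{2\pi_m(0)}{(q-1)q^m}\cdot\frac1{q^n}+O\left(\frac1{q^{2n}}\right),$$ where the implicit constant is bounded by $(\pi_m(0)^{-2}-1)^{1/2}$; that is, for all $n\ge 1$ the $O(q^{-2n})$ term is at most $(\pi_m(0)^{-2}-1)^{1/2}q^{-2n}$ in absolute value.
   Context: The matrix $M$ is chosen uniformly at random from the finite set $\mathrm{Mat}_{n\times(n+m)}(\mathbb{F}_q)$, and $\mathrm{corank}\,M=n-\mathrm{rank}\,M$. For $k\in\{0,1,\dots,\infty\}$, $\eta_k(q)=\prod_{j=1}^k(1-q^{-j})$, and $$\pi_m(i)=\frac{\eta_\infty(q)}{q^{i(i+m)}\eta_i(q)\eta_{i+m}(q)},\quad i\ge0.$$ *)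

theory Defs
  imports
    "HOL-Probability.Probability"
    "HOL-Library.Landau_Symbols"
    "HOL-Library.Extended_Nat"
    "Jordan_Normal_Form.DL_Rank"
begin

text \<open>For \<open>M \<in> carrier_mat n nc\<close> the rank is at most \<open>n\<close>, so the natural-number subtraction
  does not truncate.\<close>

definition corank :: "'a::field mat \<Rightarrow> nat" where
  "corank M = dim_row M - vec_space.rank (dim_row M) M"

definition corank_prob :: "'a::{field,finite} itself \<Rightarrow> nat \<Rightarrow> nat \<Rightarrow> nat \<Rightarrow> real" where
  "corank_prob _ n m i =
     measure_pmf.prob (pmf_of_set (carrier_mat n (n + m) :: 'a mat set)) {M. corank M = i}"

definition eta :: "enat \<Rightarrow> real \<Rightarrow> real" where
  "eta k q = (case k of
       enat k' \<Rightarrow> (\<Prod>j = 1..k'. 1 - 1 / q ^ j)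
     | \<infinity> \<Rightarrow> (\<Prod>j. 1 - 1 / q ^ Suc j))"

definition corank_limit :: "real \<Rightarrow> nat \<Rightarrow> nat \<Rightarrow> real" where
  "corank_limit q m i =
     eta \<infinity> q / (q ^ (i * (i + m)) * eta (enat i) q * eta (enat (i + m)) q)"

text \<open>\<^const>\<open>pmf_of_set\<close> and \<^const>\<open>prodinf\<close> are meaningful only for finite nonempty sets and
  convergent products respectively; the following facts show that this is the case here.\<close>

lemma finite_carrier_mat: "finite (carrier_mat nr nc :: 'a::finite mat set)"
proof -
  let ?I = "{..<nr} \<times> {..<nc}"
  have "carrier_mat nr nc \<subseteq> (\<lambda>f. mat nr nc f) ` (?I \<rightarrow>\<^sub>E (UNIV :: 'a set))"
  proof
    fix A :: "'a mat" assume A: "A \<in> carrier_mat nr nc"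
    have "A = mat nr nc (restrict (\<lambda>ij. A $$ ij) ?I)"
      using A by (intro eq_matI) auto
    then show "A \<in> (\<lambda>f. mat nr nc f) ` (?I \<rightarrow>\<^sub>E (UNIV :: 'a set))"
      by (intro image_eqI[of _ _ "restrict (\<lambda>ij. A $$ ij) ?I"]) auto
  qed
  then show ?thesis
    by (rule finite_subset) (intro finite_imageI finite_PiE, auto)
qed

lemma carrier_mat_nonempty: "carrier_mat nr nc \<noteq> ({} :: 'a::zero mat set)"
  using zero_carrier_mat[of nr nc] by blast

lemma rank_le_dim_row:
  fixes M :: "'a::field mat"
  assumes "M \<in> carrier_mat n nc"
  shows "vec_space.rank n M \<le> n"
proof -
  interpret vec_space "TYPE('a)" n .
  have "set (cols M) \<subseteq> carrier_vec n"
    using assms cols_dim by blast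
  moreover obtain S where S: "maximal S (\<lambda>T. T \<subseteq> set (cols M) \<and> lin_indpt T)"
    using maximal_exists[of "\<lambda>T. T \<subseteq> set (cols M) \<and> lin_indpt T" "card (set (cols M))" "{}"]
    by (meson List.finite_set card_mono empty_iff empty_subsetI finite_lin_indpt2 rev_finite_subset)
  ultimately have "S \<subseteq> carrier_vec n" "lin_indpt S"
    by (auto simp: maximal_def)
  then have "card S \<le> n"
    using li_le_dim(2)[of S] dim_is_n fin_dim by simp
  then show ?thesis
    using rank_card_indpt[OF assms S] by simp
qed

lemma convergent_prod_eta_infinity:
  fixes q :: real
  assumes "q > 1"
  shows "convergent_prod (\<lambda>j. 1 - 1 / q ^ Suc j)"
proof (rule abs_convergent_prod_imp_convergent_prod, rule summable_imp_abs_convergent_prod)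
  have "summable (\<lambda>j. (1 / q) * (1 / q) ^ j)"
    using assms by (intro summable_mult summable_geometric) simp
  then show "summable (\<lambda>j. norm (1 - 1 / q ^ Suc j - 1))"
    using assms by (simp add: power_one_over)
qed

end

theory Submission
  imports Defs
begin

text \<open>
  Appending a column to a matrix of rank \<open>r\<close> keeps the rank for the \<open>q\<^sup>r\<close> columns in the
  column space and raises it by one otherwise. This recursion gives the closed form
  \<open>\<eta>\<^sub>n \<eta>\<^bsub>n+m\<^esub> / (q\<^bsup>i(i+m)\<^esup> \<eta>\<^bsub>n-i\<^esub> \<eta>\<^sub>i \<eta>\<^bsub>i+m\<^esub>)\<close> for the probability of corank \<open>i\<close>, so its ratio to
  \<open>\<pi>\<^sub>m(i)\<close> is \<open>\<eta>\<^sub>n \<eta>\<^bsub>n+m\<^esub> / (\<eta>\<^bsub>n-i\<^esub> \<eta>\<^sub>\<infinity>)\<close>. The ratio is at least one for \<open>i = 0\<close> and at most one for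
  \<open>i \<ge> 1\<close>. Both distributions have total mass one (for \<open>\<pi>\<^sub>m\<close> by dominated convergence as
  \<open>n \<rightarrow> \<infinity>\<close>), hence the distance is exactly twice the difference at \<open>i = 0\<close>, that is
  \<open>2 \<pi>\<^sub>m(0) (\<eta>\<^bsub>n+m\<^esub> / \<eta>\<^sub>\<infinity> - 1)\<close>. With \<open>t = \<Sum>\<^bsub>j>n+m\<^esub> q\<^bsup>-j\<^esup>\<close> one has
  \<open>1 + t \<le> \<eta>\<^bsub>n+m\<^esub> / \<eta>\<^sub>\<infinity> \<le> 1 / (1 - t)\<close>; the linear term is the main term and the rest is
  \<open>O(t\<^sup>2)\<close>.
\<close>

section \<open>Column spaces and ranks over a finite field\<close>

context vec_space
begin

text \<open>Coefficient functions are taken extensional on \<open>S\<close>, so a vector of the span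
  has exactly one of them: the difference of two would be a linear relation on
  \<open>S\<close>.\<close>

lemma card_span_lin_indpt:
  assumes S: "finite S" "S \<subseteq> carrier_vec n" and li: "lin_indpt S"
  shows "card (span S) = CARD('a) ^ card S"
proof -
  have "bij_betw (\<lambda>a. lincomb a S) (S \<rightarrow>\<^sub>E UNIV) (span S)"
    unfolding bij_betw_def
  proof
    show "inj_on (\<lambda>a. lincomb a S) (S \<rightarrow>\<^sub>E UNIV)"
    proof (rule inj_onI)
      fix a b :: "'a vec \<Rightarrow> 'a"
      assume a: "a \<in> S \<rightarrow>\<^sub>E UNIV" and b: "b \<in> S \<rightarrow>\<^sub>E UNIV" and eq: "lincomb a S = lincomb b S"
      have "lincomb (\<lambda>v. a v - b v) S = lincomb a S - lincomb b S"
        by (rule eq_vecI) (auto simp: lincomb_index lincomb_dim S left_diff_distrib sum_subtractf)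
      also have "\<dots> = 0\<^sub>v n"
        using S by (intro eq_vecI) (auto simp: eq lincomb_dim)
      finally have "lincomb (\<lambda>v. a v - b v) S = 0\<^sub>v n" .
      then have "a v - b v = 0" if "v \<in> S" for v
        using lin_dep_crit[OF S(1) order_refl _ that, of "\<lambda>v. a v - b v"] li by auto
      then show "a = b"
        using a b by (intro PiE_ext) auto
    qed
    show "(\<lambda>a. lincomb a S) ` (S \<rightarrow>\<^sub>E UNIV) = span S"
    proof
      show "(\<lambda>a. lincomb a S) ` (S \<rightarrow>\<^sub>E UNIV) \<subseteq> span S"
        using finite_span[OF S(1)] S(2) by auto
      show "span S \<subseteq> (\<lambda>a. lincomb a S) ` (S \<rightarrow>\<^sub>E UNIV)"
      proof
        fix v assume "v \<in> span S"
        then obtain a where "v = lincomb a S"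
          using finite_span[OF S(1)] S(2) by auto
        also have "\<dots> = lincomb (restrict a S) S"
          using S by (intro lincomb_cong) auto
        finally show "v \<in> (\<lambda>a. lincomb a S) ` (S \<rightarrow>\<^sub>E UNIV)"
          by auto
      qed
    qed
  qed
  from bij_betw_same_card[OF this] show ?thesis
    using S(1) by (simp add: card_PiE)
qed

lemma card_carrier_vec: "card (carrier_vec n :: 'a vec set) = CARD('a) ^ n"
proof -
  have "card (set (unit_vecs n :: 'a vec list)) = n"
    using distinct_card[OF unit_vecs_distinct] by simp
  then show ?thesis
    using card_span_lin_indpt[of "set (unit_vecs n)"] unit_vecs_basis
    by (auto simp: span_unit_vecs_is_carrier basis_def)
qed

text \<open>A vector of \<open>S\<close> outside \<open>span U\<close> could be added to
  \<open>U\<close> without losing independence, against maximality.\<close>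

lemma span_maximal_lin_indpt:
  assumes S: "S \<subseteq> carrier_vec n" and U: "maximal U (\<lambda>T. T \<subseteq> S \<and> lin_indpt T)"
  shows "span U = span S"
proof
  have U': "U \<subseteq> S" "lin_indpt U"
    using U by (auto simp: maximal_def)
  show "span U \<subseteq> span S"
    using U'(1) by (rule span_is_monotone)
  have "v \<in> span U" if v: "v \<in> S" for v
  proof (cases "v \<in> U")
    case True
    then show ?thesis using in_own_span[of U] U' S by auto
  next
    case False
    have "lin_dep (U \<union> {v})"
      using U U' v False unfolding maximal_def by blast
    then show ?thesis
      using lin_dep_iff_in_span[of U v] U' S v False by auto
  qed
  then have "S \<subseteq> span U" by blast
  moreover have "submodule class_ring (span U) V"
    using U' S by (intro span_is_submodule) auto
  ultimately show "span S \<subseteq> span U"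
    by (rule span_is_subset)
qed

lemma rank_obtain_basis:
  assumes "A \<in> carrier_mat n k"
  obtains U where "maximal U (\<lambda>T. T \<subseteq> set (cols A) \<and> lin_indpt T)" "finite U" "U \<subseteq> carrier_vec n"
    "rank A = card U" "span U = span (set (cols A))"
proof -
  obtain U where U: "maximal U (\<lambda>T. T \<subseteq> set (cols A) \<and> lin_indpt T)"
    using maximal_exists[of "\<lambda>T. T \<subseteq> set (cols A) \<and> lin_indpt T" "card (set (cols A))" "{}"]
    by (meson List.finite_set card_mono empty_iff empty_subsetI finite_lin_indpt2 rev_finite_subset)
  have cols: "set (cols A) \<subseteq> carrier_vec n"
    using assms cols_dim by blast
  have sub: "U \<subseteq> set (cols A)"
    using U by (simp add: maximal_def)
  show ?thesis
    using that[OF U finite_subset[OF sub] subset_trans[OF sub cols] rank_card_indpt[OF assms U]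
        span_maximal_lin_indpt[OF cols U]] by simp
qed

lemma card_span_cols:
  assumes "A \<in> carrier_mat n k"
  shows "card (span (set (cols A))) = CARD('a) ^ rank A"
proof -
  obtain U where "maximal U (\<lambda>T. T \<subseteq> set (cols A) \<and> lin_indpt T)" "finite U" "U \<subseteq> carrier_vec n"
    "rank A = card U" "span U = span (set (cols A))"
    using rank_obtain_basis[OF assms] .
  then show ?thesis
    using card_span_lin_indpt[of U] by (simp add: maximal_def)
qed

text \<open>The column is appended to the list of columns, so that undoing the operation amounts to
  \<open>butlast\<close> and \<open>last\<close> on \<open>cols\<close>.\<close>

definition append_last_col :: "'a mat \<Rightarrow> 'a vec \<Rightarrow> 'a mat" where
  "append_last_col A v = mat_of_cols n (cols A @ [v])"

lemma append_last_col_carrier: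
  assumes "A \<in> carrier_mat n k"
  shows "append_last_col A v \<in> carrier_mat n (Suc k)"
  unfolding append_last_col_def using mat_of_cols_carrier(1)[of n "cols A @ [v]"] assms by simp

lemma cols_append_last_col:
  assumes "A \<in> carrier_mat n k" "v \<in> carrier_vec n"
  shows "cols (append_last_col A v) = cols A @ [v]"
proof -
  have "set (cols A @ [v]) \<subseteq> carrier_vec n"
    using assms cols_dim[of A] by simp
  then show ?thesis
    unfolding append_last_col_def by (rule cols_mat_of_cols)
qed

lemma bij_betw_append_last_col:
  "bij_betw (\<lambda>(A, v). append_last_col A v) (carrier_mat n k \<times> carrier_vec n) (carrier_mat n (Suc k))"
  unfolding bij_betw_def
proof
  show "inj_on (\<lambda>(A, v). append_last_col A v) (carrier_mat n k \<times> carrier_vec n)"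
  proof (rule inj_onI, clarify)
    fix A B :: "'a mat" and v w :: "'a vec"
    assume AB: "A \<in> carrier_mat n k" "B \<in> carrier_mat n k" "v \<in> carrier_vec n" "w \<in> carrier_vec n"
      "append_last_col A v = append_last_col B w"
    then have "cols A @ [v] = cols B @ [w]"
      by (metis cols_append_last_col)
    then have "cols A = cols B" "v = w" by auto
    then show "A = B \<and> v = w"
      using AB by (metis carrier_matD(1) mat_of_cols_cols)
  qed
  show "(\<lambda>(A, v). append_last_col A v) ` (carrier_mat n k \<times> carrier_vec n) = carrier_mat n (Suc k)"
  proof
    show "(\<lambda>(A, v). append_last_col A v) ` (carrier_mat n k \<times> carrier_vec n) \<subseteq> carrier_mat n (Suc k)"
      using append_last_col_carrier by auto
    show "carrier_mat n (Suc k) \<subseteq> (\<lambda>(A, v). append_last_col A v) ` (carrier_mat n k \<times> carrier_vec n)"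
    proof
      fix M :: "'a mat" assume M: "M \<in> carrier_mat n (Suc k)"
      define A where "A = mat_of_cols n (butlast (cols M))"
      have set: "set (cols M) \<subseteq> carrier_vec n"
        using M cols_dim by blast
      have ne: "cols M \<noteq> []"
        using M by (metis carrier_matD(2) cols_length list.size(3) nat.distinct(1))
      have "set (butlast (cols M)) \<subseteq> carrier_vec n"
        using set in_set_butlastD by fastforce
      then have "cols A = butlast (cols M)"
        unfolding A_def by (rule cols_mat_of_cols)
      then have "append_last_col A (last (cols M)) = mat_of_cols (dim_row M) (cols M)"
        using ne M by (simp add: append_last_col_def)
      then have "append_last_col A (last (cols M)) = M"
        by simp
      moreover have "A \<in> carrier_mat n k"
        using M by (intro carrier_matI) (simp_all add: A_def)
      moreover have "last (cols M) \<in> carrier_vec n"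
        using set ne by auto
      ultimately show "M \<in> (\<lambda>(A, v). append_last_col A v) ` (carrier_mat n k \<times> carrier_vec n)"
        by (intro image_eqI[of _ _ "(A, last (cols M))"]) simp_all
    qed
  qed
qed

text \<open>A column inside the column space leaves the span, and hence the rank, as it was. A
  column outside extends a maximal independent set \<open>U\<close> of columns of \<open>A\<close>
  to a maximal one for the larger matrix.\<close>

lemma rank_append_last_col:
  assumes A: "A \<in> carrier_mat n k" and v: "v \<in> carrier_vec n"
  shows "rank (append_last_col A v) = (if v \<in> span (set (cols A)) then rank A else Suc (rank A))"
proof (cases "v \<in> span (set (cols A))")
  case True
  have "set (cols A) \<subseteq> carrier_vec n"
    using A cols_dim by blast
  with True have "span (set (cols A)) = span (set (cols A) \<union> {v})"
    by (intro already_in_span) auto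
  then show ?thesis
    using True by (simp add: rank_def cols_append_last_col[OF A v])
next
  case False
  obtain U where U: "maximal U (\<lambda>T. T \<subseteq> set (cols A) \<and> lin_indpt T)" "finite U" "U \<subseteq> carrier_vec n"
    "rank A = card U" "span U = span (set (cols A))"
    using rank_obtain_basis[OF A] .
  have vU: "v \<notin> U"
    using False U in_own_span[of U] by auto
  have U': "U \<subseteq> set (cols A)" "lin_indpt U"
    using U(1) by (auto simp: maximal_def)
  have "lin_indpt (insert v U)"
    using lin_dep_iff_in_span[of U v] U U' v vU False by auto
  \<comment> \<open>Removing \<open>v\<close> from a competitor \<open>T\<close> gives an
    independent set of columns of \<open>A\<close> that contains \<open>U\<close>, which must be
    \<open>U\<close> itself.\<close>
  moreover have "T = insert v U"
    if T: "insert v U \<subseteq> T" "T \<subseteq> insert v (set (cols A))" "lin_indpt T" for T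
  proof -
    have "lin_indpt (T - {v})"
      using T(3) by (rule subset_li_is_li) auto
    moreover have "U \<subseteq> T - {v}" "T - {v} \<subseteq> set (cols A)"
      using T vU by auto
    ultimately have "T - {v} = U"
      using U(1) unfolding maximal_def by blast
    then show ?thesis using T by auto
  qed
  ultimately have "maximal (insert v U)
      (\<lambda>T. T \<subseteq> set (cols (append_last_col A v)) \<and> lin_indpt T)"
    unfolding maximal_def cols_append_last_col[OF A v] using U' by auto
  from rank_card_indpt[OF append_last_col_carrier[OF A] this]
  show ?thesis using False U vU by simp
qed

lemma rank_carrier_mat_0: "A \<in> carrier_mat n 0 \<Longrightarrow> rank A = 0"
  using rank_le_nc[of A 0] by simp

end

section \<open>Recursion for the number of matrices of given rank\<close>

definition rank_count :: "'a::{field,finite} itself \<Rightarrow> nat \<Rightarrow> nat \<Rightarrow> nat \<Rightarrow> nat" where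
  "rank_count _ n k r = card {A :: 'a mat. A \<in> carrier_mat n k \<and> vec_space.rank n A = r}"

lemma carrier_mat_no_cols: "carrier_mat n 0 = {0\<^sub>m n 0 :: 'a::zero mat}"
proof
  show "carrier_mat n 0 \<subseteq> {0\<^sub>m n 0 :: 'a mat}"
  proof
    fix A :: "'a mat" assume "A \<in> carrier_mat n 0"
    then have "A = 0\<^sub>m n 0"
      by (intro eq_matI) simp_all
    then show "A \<in> {0\<^sub>m n 0}" by simp
  qed
qed simp

lemma card_carrier_mat: "card (carrier_mat n k :: 'a::{field,finite} mat set) = CARD('a) ^ (n * k)"
proof (induction k)
  case 0
  show ?case by (simp add: carrier_mat_no_cols)
next
  case (Suc k)
  show ?case
    using bij_betw_same_card[OF vec_space.bij_betw_append_last_col[where n = n and k = k and 'a = 'a]] Suc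
    by (simp add: card_cartesian_product vec_space.card_carrier_vec power_add mult.commute)
qed

lemma rank_count_zero_cols: "rank_count TYPE('a::{field,finite}) n 0 r = (if r = 0 then 1 else 0)"
proof -
  have "{A :: 'a mat. A \<in> carrier_mat n 0 \<and> vec_space.rank n A = r} =
      (if r = 0 then {0\<^sub>m n 0} else {})"
    using vec_space.rank_carrier_mat_0[of "0\<^sub>m n 0 :: 'a mat" n] by (auto simp: carrier_mat_no_cols)
  then show ?thesis by (simp add: rank_count_def)
qed

lemma rank_count_Suc:
  fixes n k r :: nat
  defines "q \<equiv> CARD('a::{field,finite})"
  shows "rank_count TYPE('a) n (Suc k) r = q ^ r * rank_count TYPE('a) n k r +
    (case r of 0 \<Rightarrow> 0 | Suc s \<Rightarrow> (q ^ n - q ^ s) * rank_count TYPE('a) n k s)"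
proof -
  interpret vec_space "TYPE('a)" n .
  define R where "R s = {A :: 'a mat. A \<in> carrier_mat n k \<and> rank A = s}" for s
  \<comment> \<open>\<open>X\<close> holds the extensions that keep rank \<open>r\<close>,
    \<open>Y\<close> those that raise the rank to \<open>r\<close> from its predecessor. Over each
    matrix the fibre is the column space or its complement, and its size depends on the rank
    alone.\<close>
  define X where "X = (SIGMA A:R r. span (set (cols A)))"
  define Y where "Y = (SIGMA A:(case r of 0 \<Rightarrow> {} | Suc s \<Rightarrow> R s). carrier_vec n - span (set (cols A)))"
  have R_sub: "R s \<subseteq> carrier_mat n k" for s
    by (auto simp: R_def)
  have finR: "finite (R s)" for s
    using finite_subset[OF R_sub finite_carrier_mat] .
  have span_sub: "span (set (cols A)) \<subseteq> carrier_vec n" if "A \<in> carrier_mat n k" for A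
    using span_is_subset2[of "set (cols A)"] that cols_dim[of A] by simp
  have fin_vec: "finite (carrier_vec n :: 'a vec set)"
    by (rule card_ge_0_finite) (simp add: card_carrier_vec)
  have fin_span: "finite (span (set (cols A)))" if "A \<in> carrier_mat n k" for A
    using finite_subset[OF span_sub[OF that] fin_vec] .
  let ?f = "\<lambda>(A, v). append_last_col A v"
  have inj: "inj_on ?f (carrier_mat n k \<times> carrier_vec n)"
    and img: "?f ` (carrier_mat n k \<times> carrier_vec n) = carrier_mat n (Suc k)"
    using bij_betw_append_last_col[of k] by (auto simp: bij_betw_def)
  have XY_sub: "X \<union> Y \<subseteq> carrier_mat n k \<times> carrier_vec n"
    using span_sub by (auto simp: X_def Y_def R_def split: nat.splits)
  have "?f ` (X \<union> Y) = {A. A \<in> carrier_mat n (Suc k) \<and> rank A = r}"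
  proof
    show "?f ` (X \<union> Y) \<subseteq> {A. A \<in> carrier_mat n (Suc k) \<and> rank A = r}"
      using XY_sub by (auto simp: X_def Y_def R_def rank_append_last_col append_last_col_carrier
          split: nat.splits)
    show "{A. A \<in> carrier_mat n (Suc k) \<and> rank A = r} \<subseteq> ?f ` (X \<union> Y)"
    proof
      fix M :: "'a mat" assume "M \<in> {A. A \<in> carrier_mat n (Suc k) \<and> rank A = r}"
      then have M: "M \<in> ?f ` (carrier_mat n k \<times> carrier_vec n)" and r: "rank M = r"
        unfolding img by simp_all
      obtain z where z: "z \<in> carrier_mat n k \<times> carrier_vec n" "M = ?f z"
        using M by (rule imageE)
      obtain A v where "z = (A, v)"
        by (cases z)
      with z have Av: "A \<in> carrier_mat n k" "v \<in> carrier_vec n" "M = append_last_col A v"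
        by simp_all
      with r have "(A, v) \<in> X \<union> Y"
        by (auto simp: X_def Y_def R_def rank_append_last_col split: nat.splits if_splits)
      with Av(3) show "M \<in> ?f ` (X \<union> Y)"
        by (intro image_eqI[of _ _ "(A, v)"]) simp_all
    qed
  qed
  then have "rank_count TYPE('a) n (Suc k) r = card (?f ` (X \<union> Y))"
    by (simp add: rank_count_def)
  also have "\<dots> = card (X \<union> Y)"
    using inj_on_subset[OF inj XY_sub] by (rule card_image)
  also have "\<dots> = card X + card Y"
  proof (rule card_Un_disjoint)
    show "finite X" "finite Y"
      using finite_subset[OF XY_sub] finite_carrier_mat[of n k, where 'a = 'a] fin_vec by auto
    show "X \<inter> Y = {}"
      by (auto simp: X_def Y_def)
  qed
  also have "card X = q ^ r * rank_count TYPE('a) n k r"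
  proof -
    have "card X = (\<Sum>A\<in>R r. card (span (set (cols A))))"
      unfolding X_def using finR fin_span by (intro card_SigmaI) (auto simp: R_def)
    also have "\<dots> = (\<Sum>A\<in>R r. q ^ r)"
      by (intro sum.cong) (auto simp: R_def card_span_cols q_def)
    finally show ?thesis by (simp add: R_def rank_count_def)
  qed
  also have "card Y = (case r of 0 \<Rightarrow> 0 | Suc s \<Rightarrow> (q ^ n - q ^ s) * rank_count TYPE('a) n k s)"
  proof (cases r)
    case (Suc s)
    have "card Y = (\<Sum>A\<in>R s. card (carrier_vec n - span (set (cols A))))"
      unfolding Y_def Suc nat.case using finR fin_vec by (intro card_SigmaI) (auto simp: R_def)
    also have "\<dots> = (\<Sum>A\<in>R s. q ^ n - q ^ s)"
      using span_sub fin_span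
      by (intro sum.cong refl, subst card_Diff_subset)
        (auto simp: R_def card_span_cols card_carrier_vec q_def)
    finally show ?thesis by (simp add: R_def rank_count_def Suc)
  qed (simp add: Y_def)
  finally show ?thesis .
qed


section \<open>Falling products of powers of q and the closed formula\<close>

text \<open>For a prime power \<open>q\<close> this is the number of linearly independent
  \<open>r\<close>-tuples in a space of dimension \<open>x\<close>. The factor at
  \<open>i = x\<close> makes it vanish when \<open>r > x\<close>.\<close>

definition falling_q :: "real \<Rightarrow> nat \<Rightarrow> nat \<Rightarrow> real" where
  "falling_q q x r = (\<Prod>i<r. q ^ x - q ^ i)"

lemma falling_q_Suc_right: "falling_q q x (Suc r) = falling_q q x r * (q ^ x - q ^ r)"
  by (simp add: falling_q_def)

text \<open>After the factor at \<open>i = 0\<close> is split off, each of the other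
  \<open>r\<close> factors contributes one \<open>q\<close>. This is the form that matches an added
  column.\<close>

lemma falling_q_Suc_Suc: "falling_q q (Suc x) (Suc r) = (q ^ Suc x - 1) * (q ^ r * falling_q q x r)"
proof -
  have "falling_q q (Suc x) (Suc r) = (q ^ Suc x - 1) * (\<Prod>i<r. q ^ Suc x - q ^ Suc i)"
    unfolding falling_q_def by (subst prod.lessThan_Suc_shift) simp
  also have "(\<Prod>i<r. q ^ Suc x - q ^ Suc i) = (\<Prod>i<r. q * (q ^ x - q ^ i))"
    by (simp add: right_diff_distrib)
  finally show ?thesis
    by (simp add: prod.distrib falling_q_def)
qed

lemma falling_q_self_pos:
  assumes "q > 1" shows "falling_q q r r > 0"
  unfolding falling_q_def using assms by (intro prod_pos) auto

lemma eta_0 [simp]: "eta (enat 0) q = 1"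
  by (simp add: eta_def)

lemma eta_Suc: "eta (enat (Suc k)) q = eta (enat k) q * (1 - 1 / q ^ Suc k)"
  by (simp add: eta_def)

text \<open>The factor at \<open>i\<close> is \<open>q ^ x\<close> times
  \<open>1 - 1 / q ^ (x - i)\<close>, so the product collects the last \<open>r\<close> factors of
  \<open>eta (enat x) q\<close>; the missing ones are supplied on the left.\<close>

lemma falling_q_eq_eta:
  assumes "q > 1" "r \<le> x"
  shows "falling_q q x r * eta (enat (x - r)) q = q ^ (x * r) * eta (enat x) q"
  using assms(2)
proof (induction r)
  case (Suc r)
  have x: "x - r = Suc (x - Suc r)" using Suc.prems by simp
  have pw: "q ^ x = q ^ Suc (x - Suc r) * q ^ r"
    using Suc.prems by (subst power_add[symmetric]) simp
  have "q ^ x - q ^ r = q ^ x * (1 - 1 / q ^ Suc (x - Suc r))"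
    using assms(1) unfolding pw by (simp add: field_simps)
  then have "falling_q q x (Suc r) * eta (enat (x - Suc r)) q = q ^ x * (falling_q q x r * eta (enat (x - r)) q)"
    unfolding x eta_Suc falling_q_Suc_right by simp
  also have "\<dots> = q ^ (x * Suc r) * eta (enat x) q"
    using Suc by (simp add: power_add)
  finally show ?case .
qed (simp add: falling_q_def)

text \<open>The case split matters: for \<open>i > n\<close> the truncated \<open>n - i\<close> is 0
  and the quotient would stay positive.\<close>

definition corank_formula :: "real \<Rightarrow> nat \<Rightarrow> nat \<Rightarrow> nat \<Rightarrow> real" where
  "corank_formula q n m i =
     (if i \<le> n then eta (enat n) q * eta (enat (n + m)) q /
        (q ^ (i * (i + m)) * eta (enat (n - i)) q * eta (enat i) q * eta (enat (i + m)) q)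
      else 0)"

section \<open>Finite and infinite eta products\<close>

context
  fixes q :: real
  assumes q: "q \<ge> 2"
begin

private abbreviation e :: "nat \<Rightarrow> real" where "e k \<equiv> eta (enat k) q"
private abbreviation e_inf :: real where "e_inf \<equiv> eta \<infinity> q"
text \<open>The geometric sum of \<open>1 / q ^ j\<close> over all \<open>j > k\<close>.\<close>

private abbreviation tail :: "nat \<Rightarrow> real" where "tail k \<equiv> 1 / ((q - 1) * q ^ k)"

lemma eta_pos: "e k > 0"
proof -
  have "1 / q ^ j < 1" if "j \<in> {1..k}" for j
    using q that by (simp add: one_less_power)
  then show ?thesis
    by (auto simp: eta_def intro!: prod_pos)
qed

lemma eta_decseq: "decseq e"
  unfolding decseq_Suc_iff eta_Suc using eta_pos q by (simp add: mult_le_cancel_left1)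

lemma eta_le_1: "e k \<le> 1"
  using decseqD[OF eta_decseq, of 0 k] by simp

lemma eta_tendsto: "e \<longlonglongrightarrow> e_inf"
proof -
  have "(\<lambda>n. \<Prod>i\<le>n. 1 - 1 / q ^ Suc i) \<longlonglongrightarrow> e_inf"
    using convergent_prod_LIMSEQ[OF convergent_prod_eta_infinity[of q]] q by (simp add: eta_def)
  moreover have "(\<Prod>i\<le>n. 1 - 1 / q ^ Suc i) = e (Suc n)" for n
    unfolding eta_def by (simp only: enat.case One_nat_def prod.atLeast1_atMost_eq lessThan_Suc_atMost)
  ultimately have "(\<lambda>n. e (Suc n)) \<longlonglongrightarrow> e_inf" by simp
  then show ?thesis by (rule LIMSEQ_imp_Suc)
qed

text \<open>Convergence of an infinite product excludes the limit 0 when all factors are nonzero, so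
  positive factors give a positive value.\<close>

lemma eta_infinity_pos: "e_inf > 0"
proof -
  have "1 / q ^ Suc j < 1" for j
    using q one_less_power[of q "Suc j"] by simp
  then show ?thesis
    using less_0_prodinf[OF convergent_prod_eta_infinity[of q]] q by (simp add: eta_def)
qed

lemma eta_infinity_le: "e_inf \<le> e k"
  using eta_decseq eta_tendsto by (rule decseq_ge)

lemma tail_pos: "tail k > 0"
  using q by simp

lemma tail_Suc: "tail k = tail (Suc k) + 1 / q ^ Suc k"
  using q by (simp add: field_simps)

lemma tail_tendsto: "tail \<longlonglongrightarrow> 0"
proof -
  have "(\<lambda>k. 1 / (q - 1) * (1 / q) ^ k) \<longlonglongrightarrow> 1 / (q - 1) * 0"
    using q by (intro tendsto_mult tendsto_const LIMSEQ_realpow_zero) auto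
  then show ?thesis by (simp add: power_one_over)
qed

text \<open>The left side increases with \<open>k\<close> and has limit \<open>e_inf\<close>.
  Monotonicity is the Weierstrass inequality \<open>(1 - x) * (1 - t) >= 1 - (t + x)\<close>, with
  \<open>x\<close> the summand that leaves the tail.\<close>

lemma eta_infinity_ge: "e k * (1 - tail k) \<le> e_inf"
proof (rule incseq_le)
  show "incseq (\<lambda>k. e k * (1 - tail k))"
  proof (rule incseq_SucI)
    fix k
    have "1 - (t + x) \<le> (1 - x) * (1 - t)" if "x \<ge> 0" "t \<ge> 0" for x t :: real
      using mult_nonneg_nonneg[OF that] by (simp add: algebra_simps)
    then have "1 - tail k \<le> (1 - 1 / q ^ Suc k) * (1 - tail (Suc k))"
      unfolding tail_Suc[of k] using tail_pos[of "Suc k"] q by simp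
    then show "e k * (1 - tail k) \<le> e (Suc k) * (1 - tail (Suc k))"
      unfolding eta_Suc mult.assoc using eta_pos[of k] by (intro mult_left_mono) simp_all
  qed
  show "(\<lambda>k. e k * (1 - tail k)) \<longlonglongrightarrow> e_inf"
    using tendsto_mult[OF eta_tendsto tendsto_diff[OF tendsto_const[of 1] tail_tendsto]] by simp
qed

text \<open>Dually, \<open>e k / (1 + tail k)\<close> decreases to \<open>e_inf\<close>, since
  \<open>(1 - x) * (1 + t + x)\<close> falls short of \<open>1 + t\<close> by
  \<open>x * x + x * t\<close>.\<close>

lemma eta_infinity_le_tail: "e_inf * (1 + tail k) \<le> e k"
proof -
  have "e_inf \<le> e k / (1 + tail k)"
  proof (rule decseq_ge)
    show "decseq (\<lambda>k. e k / (1 + tail k))"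
      unfolding decseq_Suc_iff
    proof
      fix k
      define x where "x = 1 / q ^ Suc k"
      define t where "t = tail (Suc k)"
      have x: "x \<ge> 0" and t: "t \<ge> 0"
        using q tail_pos[of "Suc k"] by (simp_all add: x_def t_def)
      have "(1 - x) * (1 + (t + x)) \<le> 1 + t"
        using mult_nonneg_nonneg[OF x x] mult_nonneg_nonneg[OF x t] by (simp add: algebra_simps)
      then have "e k * ((1 - x) * (1 + (t + x))) \<le> e k * (1 + t)"
        using eta_pos[of k] by (intro mult_left_mono) simp_all
      then have "e k * (1 - x) / (1 + t) \<le> e k / (1 + (t + x))"
        using x t by (simp add: divide_simps mult.assoc)
      then show "e (Suc k) / (1 + tail (Suc k)) \<le> e k / (1 + tail k)"
        unfolding eta_Suc tail_Suc[of k] x_def t_def .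
    qed
    show "(\<lambda>k. e k / (1 + tail k)) \<longlonglongrightarrow> e_inf"
      using tendsto_divide[OF eta_tendsto tendsto_add[OF tendsto_const[of 1] tail_tendsto]] by simp
  qed
  then show ?thesis
    using tail_pos[of k] by (simp add: pos_le_divide_eq)
qed

section \<open>Comparison of the corank formula with its limit\<close>

lemma corank_limit_pos: "corank_limit q m i > 0"
  using q eta_pos eta_infinity_pos by (simp add: corank_limit_def)

lemma corank_formula_eq:
  assumes "i \<le> n"
  shows "corank_formula q n m i = corank_limit q m i * (e n * e (n + m) / (e (n - i) * e_inf))"
  using assms q eta_pos[of "n - i"] eta_pos[of i] eta_pos[of "i + m"] eta_infinity_pos
  by (simp add: corank_formula_def corank_limit_def)

lemma corank_formula_nonneg: "corank_formula q n m i \<ge> 0"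
  using q by (simp add: corank_formula_def eta_pos less_imp_le)

lemma corank_formula_0: "corank_formula q n m 0 = e (n + m) / e m"
  using eta_pos[of n] by (simp add: corank_formula_def)

lemma corank_limit_0: "corank_limit q m 0 = e_inf / e m"
  by (simp add: corank_limit_def)

text \<open>A majorant independent of \<open>n\<close>, for the passage to the limit under the sum.
  It follows from \<open>e n\<close> being at most \<open>e (n - i)\<close> and
  \<open>e (n + m)\<close> at most 1.\<close>

lemma corank_formula_bound: "corank_formula q n m i \<le> corank_limit q m i / e_inf"
proof (cases "i \<le> n")
  case True
  have "e n * e (n + m) \<le> e (n - i) * 1"
    using decseqD[OF eta_decseq, of "n - i" n] eta_le_1[of "n + m"] eta_pos[of "n - i"] eta_pos[of "n + m"]
    by (intro mult_mono) auto
  then have "e n * e (n + m) / (e (n - i) * e_inf) \<le> 1 / e_inf"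
    using eta_pos[of "n - i"] eta_infinity_pos by (simp add: divide_simps)
  then have "corank_limit q m i * (e n * e (n + m) / (e (n - i) * e_inf)) \<le> corank_limit q m i * (1 / e_inf)"
    using corank_limit_pos[of m i] by (intro mult_left_mono) simp_all
  then show ?thesis
    using True by (simp add: corank_formula_eq)
next
  case False
  then show ?thesis
    using corank_limit_pos[of m i] eta_infinity_pos by (simp add: corank_formula_def)
qed

text \<open>Since \<open>i >= 1\<close>, the last factor \<open>1 - 1 / q ^ n\<close> of
  \<open>e n\<close> is absent from \<open>e (n - i)\<close>. That factor is at most
  \<open>1 - tail (n + m)\<close>, which is small enough to bring \<open>e (n + m)\<close> down to
  \<open>e_inf\<close> or below.\<close>

lemma corank_formula_le_limit:
  assumes "i \<ge> 1"
  shows "corank_formula q n m i \<le> corank_limit q m i"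
proof (cases "i \<le> n")
  case True
  then obtain n' where n': "n = Suc n'" and i: "n - i \<le> n'"
    using assms by (cases n) auto
  have "tail (n + m) \<le> 1 / q ^ n"
    using q mult_mono[of 1 "q - 1" "q ^ n" "q ^ (n + m)"]
    by (intro divide_left_mono) (auto intro: power_increasing)
  then have "e (n + m) * (1 - 1 / q ^ n) \<le> e (n + m) * (1 - tail (n + m))"
    using eta_pos[of "n + m"] by (intro mult_left_mono) simp_all
  also have "\<dots> \<le> e_inf"
    by (rule eta_infinity_ge)
  finally have "e n' * (e (n + m) * (1 - 1 / q ^ n)) \<le> e (n - i) * e_inf"
    using decseqD[OF eta_decseq i] eta_pos[of n'] eta_pos[of "n + m"] eta_pos[of "n - i"] q
    by (intro mult_mono) auto
  then have "e n * e (n + m) / (e (n - i) * e_inf) \<le> 1"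
    using eta_pos[of "n - i"] eta_infinity_pos by (simp add: n' eta_Suc mult_ac)
  then show ?thesis
    unfolding corank_formula_eq[OF True] using corank_limit_pos[of m i]
    by (intro mult_left_le) simp_all
next
  case False
  then show ?thesis
    using corank_limit_pos[of m i] by (simp add: corank_formula_def)
qed

lemma corank_formula_tendsto: "(\<lambda>n. corank_formula q n m i) \<longlonglongrightarrow> corank_limit q m i"
proof -
  have sub: "(\<lambda>n. e (n - i)) \<longlonglongrightarrow> e_inf"
    by (rule LIMSEQ_offset[of _ i]) (simp add: eta_tendsto)
  have add: "(\<lambda>n. e (n + m)) \<longlonglongrightarrow> e_inf"
    by (rule LIMSEQ_ignore_initial_segment[OF eta_tendsto])
  have "(\<lambda>n. corank_limit q m i * (e n * e (n + m) / (e (n - i) * e_inf)))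
      \<longlonglongrightarrow> corank_limit q m i * (e_inf * e_inf / (e_inf * e_inf))"
    by (intro tendsto_intros sub add eta_tendsto) (use eta_infinity_pos in simp)
  then have "(\<lambda>n. corank_limit q m i * (e n * e (n + m) / (e (n - i) * e_inf))) \<longlonglongrightarrow> corank_limit q m i"
    using eta_infinity_pos by simp
  then show ?thesis
    by (rule Lim_transform_eventually)
      (use eventually_ge_at_top[of i] in eventually_elim, simp add: corank_formula_eq)
qed

text \<open>Partial sums of the limit are limits of partial sums that are at most 1, which gives
  summability. The majorant is then summable, and Tannery's theorem shows that no mass escapes. The
  hypothesis \<open>total\<close> is later supplied by the probabilistic meaning of the
  formula.\<close>

lemma corank_limit_sums:
  assumes total: "\<And>n. (\<Sum>i\<le>n. corank_formula q n m i) = 1"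
  shows "corank_limit q m sums 1"
proof -
  have sums: "corank_formula q n m sums 1" for n
    using sums_finite[of "{..n}" "corank_formula q n m"] total by (simp add: corank_formula_def)
  have bounded: "(\<Sum>i<N. corank_limit q m i) \<le> 1" for N
  proof (rule LIMSEQ_le_const2)
    show "(\<lambda>n. \<Sum>i<N. corank_formula q n m i) \<longlonglongrightarrow> (\<Sum>i<N. corank_limit q m i)"
      by (intro tendsto_sum corank_formula_tendsto)
    have "(\<Sum>i<N. corank_formula q n m i) \<le> 1" for n
      using sum_le_suminf[OF sums_summable[OF sums[of n]], of "{..<N}"] sums_unique[OF sums[of n]]
      by (simp add: corank_formula_nonneg)
    then show "\<exists>M. \<forall>n\<ge>M. (\<Sum>i<N. corank_formula q n m i) \<le> 1"
      by blast
  qed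
  have summable: "summable (corank_limit q m)"
    using corank_limit_pos bounded
    by (intro bounded_imp_summable[where B = 1]) (auto intro: less_imp_le simp only: lessThan_Suc_atMost[symmetric])
  have bound: "eventually (\<lambda>(i, n). norm (corank_formula q n m i) \<le> corank_limit q m i / e_inf)
      (at_top \<times>\<^sub>F sequentially)"
    by (rule always_eventually) (auto simp: corank_formula_nonneg corank_formula_bound)
  have "(\<lambda>n. \<Sum>i. corank_formula q n m i) \<longlonglongrightarrow> suminf (corank_limit q m)"
    using tannerys_theorem[OF corank_formula_tendsto bound summable_divide[OF summable] trivial_limit_sequentially]
    by simp
  then have "(\<lambda>n. 1) \<longlonglongrightarrow> suminf (corank_limit q m)"
    using sums_unique[OF sums] by simp
  then have "suminf (corank_limit q m) = 1"
    using LIMSEQ_unique tendsto_const by blast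
  with summable show ?thesis
    by (simp add: sums_iff)
qed

lemma corank_distance_sums:
  assumes total: "\<And>n. (\<Sum>i\<le>n. corank_formula q n m i) = 1"
  shows "(\<lambda>i. \<bar>corank_formula q n m i - corank_limit q m i\<bar>) sums (2 * corank_limit q m 0 * (e (n + m) / e_inf - 1))"
proof -
  have "corank_formula q n m sums 1"
    using sums_finite[of "{..n}" "corank_formula q n m"] total by (simp add: corank_formula_def)
  then have "(\<lambda>i. corank_limit q m i - corank_formula q n m i) sums (1 - 1)"
    by (intro sums_diff corank_limit_sums total)
  \<comment> \<open>Only the term at \<open>i = 0\<close> has the wrong sign. Adding twice its
    absolute value turns the signed differences, whose sum is 0, into absolute values.\<close>
  moreover have "(\<lambda>i. if i = 0 then 2 * (corank_formula q n m 0 - corank_limit q m 0) else 0) sums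
      (2 * (corank_formula q n m 0 - corank_limit q m 0))"
    by (rule sums_If_finite_set[of "{0}", simplified])
  ultimately have "(\<lambda>i. corank_limit q m i - corank_formula q n m i
       + (if i = 0 then 2 * (corank_formula q n m 0 - corank_limit q m 0) else 0))
      sums (1 - 1 + 2 * (corank_formula q n m 0 - corank_limit q m 0))"
    by (rule sums_add)
  moreover have "corank_limit q m i - corank_formula q n m i
       + (if i = 0 then 2 * (corank_formula q n m 0 - corank_limit q m 0) else 0)
      = \<bar>corank_formula q n m i - corank_limit q m i\<bar>" for i
  proof (cases "i = 0")
    case True
    have "corank_limit q m 0 \<le> corank_formula q n m 0"
      unfolding corank_formula_0 corank_limit_0
      using eta_infinity_le eta_pos[of m] by (intro divide_right_mono) auto
    then show ?thesis using True by simp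
  next
    case False
    then show ?thesis
      using corank_formula_le_limit[of i n m] by simp
  qed
  moreover have "corank_formula q n m 0 - corank_limit q m 0 = corank_limit q m 0 * (e (n + m) / e_inf - 1)"
    unfolding corank_formula_0 corank_limit_0
    using eta_pos[of m] eta_infinity_pos by (simp add: field_simps)
  ultimately show ?thesis by (simp add: mult.assoc)
qed

section \<open>Second-order estimate and the error constant\<close>

lemma eta_quotient_bounds:
  assumes "k \<ge> 1"
  shows "0 \<le> e k / e_inf - 1 - tail k" "e k / e_inf - 1 - tail k \<le> 2 * (tail k)\<^sup>2"
proof -
  define t where "t = tail k"
  \<comment> \<open>The condition \<open>k >= 1\<close> enters here: it forces \<open>t\<close> to
    be at most 1/2, so that the remainder \<open>t^2 / (1 - t)\<close> of the geometric series is at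
    most \<open>2 * t^2\<close>.\<close>
  have "1 * 2 \<le> (q - 1) * q ^ k"
    using q assms power_increasing[of 1 k q] by (intro mult_mono) auto
  then have t: "0 \<le> t" "t \<le> 1 / 2"
    using q by (auto simp: t_def divide_simps)
  have "1 + t \<le> e k / e_inf"
    using eta_infinity_le_tail[of k] eta_infinity_pos by (simp add: t_def pos_le_divide_eq mult.commute)
  then show "0 \<le> e k / e_inf - 1 - tail k"
    by (simp add: t_def)
  have "e k / e_inf \<le> 1 / (1 - t)"
    using eta_infinity_ge[of k] eta_infinity_pos t
    by (simp add: t_def[symmetric] divide_simps)
  also have "1 / (1 - t) \<le> 1 + t + 2 * t\<^sup>2"
  proof -
    have "(1 + t + 2 * t\<^sup>2) * (1 - t) - 1 = t\<^sup>2 * (1 - 2 * t)"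
      by (simp add: power2_eq_square algebra_simps)
    also have "\<dots> \<ge> 0"
      using t by (intro mult_nonneg_nonneg) auto
    finally show ?thesis
      using t by (simp add: divide_le_eq)
  qed
  finally show "e k / e_inf - 1 - tail k \<le> 2 * (tail k)\<^sup>2"
    by (simp add: t_def)
qed

end

text \<open>With \<open>z = 1 / ((q - 1) q\<^sup>m)\<close> the generic estimate \<open>p (1 + z) \<le> 1\<close> suffices if \<open>z \<le> 1/2\<close>; the
  only other case is \<open>q = 2\<close>, \<open>m = 0\<close>, where it is too weak and \<open>p \<le> \<eta>\<^sub>2(2) = 3/8\<close> is used.\<close>

lemma error_constant_bound:
  fixes q m :: nat
  assumes q: "q \<ge> 2"
  defines "p \<equiv> corank_limit (real q) m 0"
  shows "4 * p * (1 / ((real q - 1) * real q ^ m))\<^sup>2 \<le> sqrt (1 / p\<^sup>2 - 1)"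
proof (rule real_le_rsqrt)
  define z where "z = 1 / ((real q - 1) * real q ^ m)"
  have q': "real q \<ge> 2" using q by simp
  have p: "p > 0"
    unfolding p_def by (rule corank_limit_pos[OF q'])
  have z: "z > 0"
    unfolding z_def by (rule tail_pos[OF q'])
  have pz: "p * (1 + z) \<le> 1"
    using eta_infinity_le_tail[OF q', of m] eta_pos[OF q', of m]
    by (simp add: p_def z_def corank_limit_0[OF q'])
  then have inv: "1 + z \<le> 1 / p"
    using p by (simp add: pos_le_divide_eq mult.commute)
  have p1: "p \<le> 1"
    using pz mult_pos_pos[OF p z] by (simp add: distrib_left)
  show "(4 * p * (1 / ((real q - 1) * real q ^ m))\<^sup>2)\<^sup>2 \<le> 1 / p\<^sup>2 - 1"
    unfolding z_def[symmetric]
  proof (cases "z \<le> 1 / 2")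
    case True
    \<comment> \<open>One factor \<open>z\<close> is kept and the other three are bounded by 1/2,
      which gives the bound \<open>2 * z\<close>, the linear part of
      \<open>(1 + z)^2 - 1\<close>.\<close>
    have "(4 * p * z\<^sup>2)\<^sup>2 = 16 * (p\<^sup>2 * (z * (z * z\<^sup>2)))"
      by (simp add: power2_eq_square algebra_simps)
    also have "\<dots> \<le> 16 * (1 * (z * (1 / 2 * (1 / 2)\<^sup>2)))"
      using True z p p1 by (intro mult_left_mono mult_mono power_mono power_le_one) auto
    also have "\<dots> \<le> (1 + z)\<^sup>2 - 1"
      by (simp add: power2_eq_square algebra_simps)
    also have "\<dots> \<le> (1 / p)\<^sup>2 - 1"
      using inv z by (intro diff_right_mono power_mono) auto
    finally show "(4 * p * z\<^sup>2)\<^sup>2 \<le> 1 / p\<^sup>2 - 1"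
      by (simp add: power_one_over)
  next
    case False
    have "(real q - 1) * real q ^ m < 2"
      using False z by (simp add: z_def divide_simps split: if_splits)
    have "m = 0"
    proof (rule ccontr)
      assume "m \<noteq> 0"
      then have "real q ^ 1 \<le> real q ^ m"
        using q' by (intro power_increasing) simp_all
      then have "2 \<le> real q ^ m"
        using q' unfolding power_one_right by linarith
      then have "1 * 2 \<le> (real q - 1) * real q ^ m"
        using q' by (intro mult_mono) simp_all
      with \<open>(real q - 1) * real q ^ m < 2\<close> show False by simp
    qed
    then have "q = 2"
      using \<open>(real q - 1) * real q ^ m < 2\<close> q by simp
    have "p = eta \<infinity> 2"
      unfolding p_def by (simp add: corank_limit_0[of 2] \<open>m = 0\<close> \<open>q = 2\<close>)
    then have "p \<le> eta (enat 2) 2"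
      using eta_infinity_le[of 2 2] by simp
    also have "eta (enat 2) 2 = 3 / 8"
      by (simp add: eta_def numeral_2_eq_2)
    finally have p38: "p \<le> 3 / 8" .
    have "(4 * p * z\<^sup>2)\<^sup>2 = 16 * p\<^sup>2"
      by (simp add: z_def \<open>m = 0\<close> \<open>q = 2\<close> power2_eq_square)
    also have "\<dots> \<le> 16 * (3 / 8)\<^sup>2"
      using p p38 by (intro mult_left_mono power_mono) auto
    also have "\<dots> \<le> (8 / 3)\<^sup>2 - (1 :: real)"
      by (simp add: power2_eq_square)
    also have "\<dots> \<le> (1 / p)\<^sup>2 - 1"
      using p p38 by (intro diff_right_mono power_mono) (auto simp: divide_simps)
    finally show "(4 * p * z\<^sup>2)\<^sup>2 \<le> 1 / p\<^sup>2 - 1"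
      by (simp add: power_one_over)
  qed
qed

section \<open>Exact rank counts and the corank distribution\<close>

lemma CARD_field_ge_2: "CARD('a::{field,finite}) \<ge> 2"
proof -
  have "card {0, 1 :: 'a} \<le> CARD('a)"
    by (rule card_mono) auto
  then show ?thesis by simp
qed

text \<open>Induction on the number of columns, for all \<open>r\<close> at once because the
  recursion links \<open>r\<close> to its predecessor. The factor \<open>falling_q q r r\<close> is
  the order of the general linear group of degree \<open>r\<close>, kept on the left to avoid
  division.\<close>

lemma rank_count_falling_q:
  fixes n k r :: nat
  defines "q \<equiv> real CARD('a::{field,finite})"
  shows "real (rank_count TYPE('a) n k r) * falling_q q r r = falling_q q n r * falling_q q k r"
proof (induction k arbitrary: r)
  case 0
  show ?case
    by (cases r) (simp_all add: rank_count_zero_cols falling_q_def prod.lessThan_Suc_shift del: prod.lessThan_Suc)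
next
  case (Suc k)
  have q: "q > 1"
    using CARD_field_ge_2[where 'a = 'a] by (simp add: q_def)
  show ?case
  proof (cases r)
    case 0
    then show ?thesis
      using Suc[of 0] by (simp add: rank_count_Suc falling_q_def)
  next
    case (Suc s)
    define A where "A = falling_q q n s"
    define B where "B = falling_q q k s"
    define G where "G = falling_q q s s"
    have G: "G > 0"
      unfolding G_def by (rule falling_q_self_pos[OF q])
    have c_s: "real (rank_count TYPE('a) n k s) * G = A * B"
      using Suc.IH[of s] by (simp add: A_def B_def G_def)
    have GS: "falling_q q (Suc s) (Suc s) = (q ^ Suc s - 1) * (q ^ s * G)"
      unfolding falling_q_Suc_Suc G_def ..
    have c_r: "real (rank_count TYPE('a) n k (Suc s)) * ((q ^ Suc s - 1) * (q ^ s * G)) =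
        A * (q ^ n - q ^ s) * (B * (q ^ k - q ^ s))"
      using Suc.IH[of "Suc s"] unfolding GS
      unfolding falling_q_Suc_right[of q n] falling_q_Suc_right[of q k] A_def B_def .
    \<comment> \<open>Subtraction of naturals truncates when \<open>s > n\<close>, but then the
      count it multiplies is 0.\<close>
    have diff: "real ((CARD('a) ^ n - CARD('a) ^ s) * rank_count TYPE('a) n k s) =
        (q ^ n - q ^ s) * real (rank_count TYPE('a) n k s)"
    proof (cases "s \<le> n")
      case True
      then have "CARD('a) ^ s \<le> CARD('a) ^ n"
        by (intro power_increasing) (simp_all add: Suc_le_eq)
      then show ?thesis
        by (simp add: of_nat_diff q_def)
    next
      case False
      then have "A = 0"
        by (auto simp: A_def falling_q_def)
      then have "rank_count TYPE('a) n k s = 0"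
        using c_s G by simp
      then show ?thesis by simp
    qed
    have step: "real (rank_count TYPE('a) n (Suc k) (Suc s)) =
        q ^ Suc s * real (rank_count TYPE('a) n k (Suc s))
        + (q ^ n - q ^ s) * real (rank_count TYPE('a) n k s)"
      unfolding rank_count_Suc[of n k "Suc s"] nat.case of_nat_add diff by (simp add: q_def)
    have "real (rank_count TYPE('a) n (Suc k) (Suc s)) * falling_q q (Suc s) (Suc s) =
        q ^ Suc s * (real (rank_count TYPE('a) n k (Suc s)) * ((q ^ Suc s - 1) * (q ^ s * G)))
        + (q ^ n - q ^ s) * (q ^ Suc s - 1) * q ^ s * (real (rank_count TYPE('a) n k s) * G)"
      unfolding GS step by (simp add: algebra_simps)
    \<comment> \<open>The recursion reduces to \<open>q ^ Suc s * (q ^ k - q ^ s) + (q ^ Suc s - 1)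
      * q ^ s = q ^ s * (q ^ Suc k - 1)\<close>.\<close>
    also have "\<dots> = A * (q ^ n - q ^ s) * ((q ^ Suc k - 1) * (q ^ s * B))"
      unfolding c_r c_s by (simp add: algebra_simps)
    also have "\<dots> = falling_q q n (Suc s) * falling_q q (Suc k) (Suc s)"
      unfolding falling_q_Suc_Suc falling_q_Suc_right[of q n] A_def B_def ..
    finally show ?thesis using Suc by simp
  qed
qed

lemma corank_prob_eq:
  fixes n m i :: nat
  defines "q \<equiv> real CARD('a::{field,finite})"
  shows "corank_prob TYPE('a) n m i = corank_formula q n m i"
proof -
  have q: "q \<ge> 2"
    using CARD_field_ge_2[where 'a = 'a] by (simp add: q_def)
  have prob: "corank_prob TYPE('a) n m i =
      real (card (carrier_mat n (n + m) \<inter> {M :: 'a mat. corank M = i})) / q ^ (n * (n + m))"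
    unfolding corank_prob_def
    by (simp add: measure_pmf_of_set finite_carrier_mat carrier_mat_nonempty card_carrier_mat q_def)
  have corank: "corank M = i \<longleftrightarrow> i \<le> n \<and> vec_space.rank n M = n - i"
    if "M \<in> carrier_mat n (n + m)" for M :: "'a mat"
    using rank_le_dim_row[OF that] that by (auto simp: corank_def)
  show ?thesis
  proof (cases "i \<le> n")
    case False
    then have "carrier_mat n (n + m) \<inter> {M :: 'a mat. corank M = i} = {}"
      using corank by auto
    then show ?thesis
      unfolding prob using False by (simp add: corank_formula_def)
  next
    case True
    define r where "r = n - i"
    have n: "n = r + i" and r: "r \<le> n" "r \<le> n + m"
      using True by (simp_all add: r_def)
    have ni: "n - r = i" "n + m - r = i + m"
      using True by (simp_all add: r_def)
    define N where "N = real (rank_count TYPE('a) n (n + m) r)"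
    have "carrier_mat n (n + m) \<inter> {M :: 'a mat. corank M = i} =
        {M. M \<in> carrier_mat n (n + m) \<and> vec_space.rank n M = r}"
      using corank True by (auto simp: r_def)
    then have P: "corank_prob TYPE('a) n m i = N / q ^ (n * (n + m))"
      unfolding prob by (simp add: N_def rank_count_def)
    have count: "N * falling_q q r r = falling_q q n r * falling_q q (n + m) r"
      unfolding N_def q_def by (rule rank_count_falling_q)
    \<comment> \<open>The two added eta factors complete both falling products to
      \<open>eta (enat n) q\<close> and \<open>eta (enat (n + m)) q\<close>.\<close>
    have "N * (q ^ (r * r) * eta (enat r) q) * (eta (enat i) q * eta (enat (i + m)) q) =
        (falling_q q n r * eta (enat i) q) * (falling_q q (n + m) r * eta (enat (i + m)) q)"
      using falling_q_eq_eta[of q r r] count q by (simp add: mult_ac)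
    also have "\<dots> = (q ^ (n * r) * eta (enat n) q) * (q ^ ((n + m) * r) * eta (enat (n + m)) q)"
      using falling_q_eq_eta[of q r n] falling_q_eq_eta[of q r "n + m"] q r ni by simp
    finally have "N * (q ^ (r * r) * eta (enat r) q) * (eta (enat i) q * eta (enat (i + m)) q) * q ^ (i * (i + m))
        = eta (enat n) q * eta (enat (n + m)) q * (q ^ (n * r) * q ^ ((n + m) * r) * q ^ (i * (i + m)))"
      by (simp add: mult_ac)
    \<comment> \<open>With \<open>n = r + i\<close>, both exponents equal
      \<open>r * r + n * (n + m)\<close>.\<close>
    also have "q ^ (n * r) * q ^ ((n + m) * r) * q ^ (i * (i + m)) = q ^ (r * r) * q ^ (n * (n + m))"
      unfolding power_add[symmetric] by (rule arg_cong[where f = "power q"]) (simp add: n algebra_simps)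
    finally have "q ^ (r * r) * (N * (q ^ (i * (i + m)) * eta (enat r) q * eta (enat i) q * eta (enat (i + m)) q))
        = q ^ (r * r) * (eta (enat n) q * eta (enat (n + m)) q * q ^ (n * (n + m)))"
      by (simp add: mult_ac)
    then have "N * (q ^ (i * (i + m)) * eta (enat r) q * eta (enat i) q * eta (enat (i + m)) q)
        = eta (enat n) q * eta (enat (n + m)) q * q ^ (n * (n + m))"
      using q by simp
    then show ?thesis
      unfolding P corank_formula_def using True q eta_pos[OF q, of r] eta_pos[OF q, of i] eta_pos[OF q, of "i + m"]
      by (simp add: frac_eq_eq r_def[symmetric])
  qed
qed

text \<open>The corank never exceeds the number of rows, so these disjoint events exhaust the
  support.\<close>

lemma corank_prob_total:
  "(\<Sum>i\<le>n. corank_prob TYPE('a::{field,finite}) n m i) = 1"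
proof -
  let ?M = "measure_pmf (pmf_of_set (carrier_mat n (n + m) :: 'a mat set))"
  have "(\<Sum>i\<le>n. corank_prob TYPE('a) n m i) = measure ?M (\<Union>i\<le>n. {M. corank M = i})"
    unfolding corank_prob_def
    by (rule measure_pmf.finite_measure_finite_Union[symmetric]) (auto simp: disjoint_family_on_def)
  also have "\<dots> = 1"
    by (subst measure_pmf.prob_eq_1)
      (auto simp: AE_measure_pmf_iff finite_carrier_mat carrier_mat_nonempty corank_def)
  finally show ?thesis .
qed

section \<open>The expansion of the distance\<close>

theorem corollary7:
  fixes q m :: nat
  assumes "q = CARD('a::{field,finite})"
  shows "\<exists>E :: nat \<Rightarrow> real.
      E \<in> O(\<lambda>n. 1 / real q ^ (2 * n)) \<and>
      (\<forall>n\<ge>1.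
         (\<lambda>i. \<bar>corank_prob TYPE('a) n m i - corank_limit q m i\<bar>) sums
           (2 * corank_limit q m 0 / ((real q - 1) * real q ^ m) * (1 / real q ^ n) + E n) \<and>
         \<bar>E n\<bar> \<le> sqrt (1 / (corank_limit q m 0)\<^sup>2 - 1) * (1 / real q ^ (2 * n)))"
proof -
  have q2: "q \<ge> 2"
    using CARD_field_ge_2[where 'a = 'a] assms by simp
  then have q: "real q \<ge> 2" by simp
  define p where "p = corank_limit (real q) m 0"
  define C where "C = sqrt (1 / p\<^sup>2 - 1)"
  define t where "t n = 1 / ((real q - 1) * real q ^ n)" for n
  \<comment> \<open>The exact distance minus its main term, which equals
    \<open>2 * p * t (n + m)\<close>.\<close>
  define E where "E n = 2 * p * (eta (enat (n + m)) (real q) / eta \<infinity> (real q) - 1 - t (n + m))" for n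
  have p: "p > 0"
    unfolding p_def by (rule corank_limit_pos[OF q])
  have prob: "corank_prob TYPE('a) n m i = corank_formula (real q) n m i" for n i
    unfolding assms by (rule corank_prob_eq)
  have total: "(\<Sum>i\<le>n. corank_formula (real q) n m i) = 1" for n
    using corank_prob_total[where 'a = 'a, of n m] by (simp add: prob)
  have bound: "\<bar>E n\<bar> \<le> C * (1 / real q ^ (2 * n))" if n: "n \<ge> 1" for n
  proof -
    have "0 \<le> E n"
      unfolding E_def t_def using p eta_quotient_bounds(1)[OF q, of "n + m"] n by simp
    moreover have "E n \<le> 2 * p * (2 * (t (n + m))\<^sup>2)"
      unfolding E_def t_def using p eta_quotient_bounds(2)[OF q, of "n + m"] n
      by (intro mult_left_mono) simp_all
    \<comment> \<open>Here \<open>t (n + m)\<close> is \<open>t m / q ^ n\<close>, so the dependence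
      on \<open>n\<close> separates from the constant.\<close>
    moreover have "2 * p * (2 * (t (n + m))\<^sup>2) = 4 * p * (t m)\<^sup>2 * (1 / real q ^ (2 * n))"
      using q by (simp add: t_def power_add power_mult_distrib power_divide power_mult[symmetric] mult_ac)
    moreover have "4 * p * (t m)\<^sup>2 * (1 / real q ^ (2 * n)) \<le> C * (1 / real q ^ (2 * n))"
      unfolding C_def p_def t_def using error_constant_bound[OF q2, of m] by (intro mult_right_mono) simp_all
    ultimately show ?thesis by linarith
  qed
  have "E \<in> O(\<lambda>n. 1 / real q ^ (2 * n))"
    by (rule bigoI[of _ C]) (use eventually_ge_at_top[of 1] in eventually_elim, use bound in simp)
  moreover have "(\<lambda>i. \<bar>corank_prob TYPE('a) n m i - corank_limit q m i\<bar>) sums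
      (2 * p / ((real q - 1) * real q ^ m) * (1 / real q ^ n) + E n)" for n
  proof -
    have "2 * p * (eta (enat (n + m)) (real q) / eta \<infinity> (real q) - 1) =
        2 * p / ((real q - 1) * real q ^ m) * (1 / real q ^ n) + E n"
      by (simp add: E_def t_def power_add algebra_simps)
    then show ?thesis
      using corank_distance_sums[OF q total, of n] unfolding prob p_def by simp
  qed
  ultimately show ?thesis
    using bound unfolding p_def C_def by blast
qed

end
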